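(* Let $f\in\mathcal{F}^p_{\lambda,a}(K)$, with conjugacy function $g$. Then the semi-conjugacy $g\circ f(x)=\lambda g(x)$ holds on the open disc $D_\rho(0)$. Moreover, the full conjugacy $g\circ f\circ g^{-1}(x)=\lambda x$ holds on $D_\sigma(0)$. Here \[ \rho=\frac{|1-\lambda^m|^{\frac1{mp}}}{a},\qquad \sigma=\frac{|1-\lambda^m|^{\frac1{k'-1}}}{a}. \]
   Context: $K$ is a field of characteristic $p>0$, complete with respect to a nontrivial absolute value $|\cdot|$ (necessarily non-Archimedean); $D_r(0)=\{x\in K:|x|<r\}$. The element $\lambda\in K$ is not a root of unity and is such that $m=m(\lambda)=\min\{n\in\mathbb Z:n\ge1,\ |1-\lambda^n|<1\}$ exists (so $|\lambda|=1$; one has $p\nmid m$). $k'=k'(\lambda)=\min\{k\in\mathbb Z:k\ge1,\ p\mid k,\ m\mid k-1\}$. For a real number $a>0$, \[ \mathcal F^p_{\lambda,a}(K)=\Big\{\lambda x+\sum_{i\ge2,\ p\mid i}a_ix^i\in K[[x]]:\ a=\sup_{i\ge2}|a_i|^{1/(i-1)}\Big\}. \] The conjugacy function $g$ of $f$ is the unique power series solution, with $g(0)=0$ and $g'(0)=1$, of the Schröder functional equation $g\circ f(x)=\lambda g(x)$. The semi-conjugacy holds on a disc $V$ about $0$ if $g$ and $f$ converge on $V$ and $g(f(x))=\lambda g(x)$ for all $x\in V$. The full conjugacy holds on a disc $U$ about $0$ if $g$ converges and is one-to-one on $U$, the compositional inverse power series $g^{-1}$ converges on $U$, and $g(f(g^{-1}(x)))=\lambda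 x$ for all $x\in U$. *)

theory Defs
  imports Complex_Main "HOL-Computational_Algebra.Computational_Algebra"
begin

unbundle fps_syntax

text \<open>
  Fields with an absolute value whose metric is the induced one. The library classes
  \<^class>\<open>real_normed_field\<close> and the like presuppose a real vector space structure, which excludes
  positive characteristic. Completeness is the sort \<^class>\<open>complete_space\<close>.
\<close>

class abs_valued_field = field + metric_space +
  fixes abs_val :: "'a \<Rightarrow> real"
  assumes abs_val_nonneg: "0 \<le> abs_val x"
    and abs_val_eq_zero: "abs_val x = 0 \<longleftrightarrow> x = 0"
    and abs_val_mult: "abs_val (x * y) = abs_val x * abs_val y"
    and abs_val_triangle: "abs_val (x + y) \<le> abs_val x + abs_val y"
    and dist_abs_val: "dist x y = abs_val (x - y)"

definition nontrivial_abs_val :: "'a::abs_valued_field itself \<Rightarrow> bool" where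
  "nontrivial_abs_val _ \<longleftrightarrow> (\<exists>x::'a. x \<noteq> 0 \<and> abs_val x \<noteq> 1)"

definition open_disc :: "real \<Rightarrow> 'a::abs_valued_field set" where
  "open_disc r = {x. abs_val x < r}"

definition root_of_unity :: "'a::field \<Rightarrow> bool" where
  "root_of_unity l \<longleftrightarrow> (\<exists>n\<ge>1. l ^ n = 1)"

definition m_exists :: "'a::abs_valued_field \<Rightarrow> bool" where
  "m_exists l \<longleftrightarrow> (\<exists>n::nat. n \<ge> 1 \<and> abs_val (1 - l ^ n) < 1)"

definition m_of :: "'a::abs_valued_field \<Rightarrow> nat" where
  "m_of l = (LEAST n. n \<ge> 1 \<and> abs_val (1 - l ^ n) < 1)"

definition k'_of :: "'a::abs_valued_field \<Rightarrow> nat" where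
  "k'_of l = (LEAST k. k \<ge> 1 \<and> CHAR('a) dvd k \<and> m_of l dvd k - 1)"

text \<open>
  The boundedness condition is not redundant: the supremum defining \<open>a\<close> is required to be finite,
  and \<open>Sup\<close> on the reals is unspecified for unbounded sets.
\<close>

definition F_family :: "'a::abs_valued_field \<Rightarrow> real \<Rightarrow> 'a fps set" where
  "F_family l a = {f. f $ 0 = 0 \<and> f $ 1 = l \<and> (\<forall>i\<ge>2. \<not> CHAR('a) dvd i \<longrightarrow> f $ i = 0)
     \<and> bdd_above ((\<lambda>i. abs_val (f $ i) powr (1 / (real i - 1))) ` {2..})
     \<and> a = (SUP i\<in>{2..}. abs_val (f $ i) powr (1 / (real i - 1)))}"

definition is_conjugacy :: "'a::field \<Rightarrow> 'a fps \<Rightarrow> 'a fps \<Rightarrow> bool" where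
  "is_conjugacy l f g \<longleftrightarrow> g $ 0 = 0 \<and> g $ 1 = 1 \<and> g oo f = fps_const l * g"

definition conjugacy_function :: "'a::field \<Rightarrow> 'a fps \<Rightarrow> 'a fps" where
  "conjugacy_function l f = (THE g. is_conjugacy l f g)"

fun conjugacy_coeff :: "'a::field \<Rightarrow> 'a fps \<Rightarrow> nat \<Rightarrow> 'a" where
  "conjugacy_coeff l f n = (if n = 0 then 0 else if n = 1 then 1 else
     (\<Sum>i\<in>{..<n}. conjugacy_coeff l f i * (f ^ i) $ n) / (l - l ^ n))"

declare conjugacy_coeff.simps [simp del]

text \<open>The definite description above is meaningful in the situation of interest.\<close>

lemma is_conjugacy_ex1:
  fixes l :: "'a::field"
  assumes l: "l \<noteq> 0" "\<not> root_of_unity l" and f: "f $ 0 = 0" "f $ 1 = l"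
  shows "\<exists>!g. is_conjugacy l f g"
proof -
  have comp: "(g oo f) $ n = (\<Sum>i\<in>{..<n}. g $ i * (f ^ i) $ n) + g $ n * l ^ n" for g n
  proof -
    have "{0..n} = insert n {..<n}" by auto
    then show ?thesis
      using startsby_zero_power_nth_same[OF f(1), of n] f(2)
      by (simp add: fps_compose_nth add.commute)
  qed
  have ne: "l - l ^ n \<noteq> 0" if n2: "n \<ge> 2" for n
  proof
    assume "l - l ^ n = 0"
    moreover obtain k where "n = Suc k" "k \<ge> 1" using n2 that[of "n - 1"] by auto
    ultimately have "l ^ k = 1" using l(1) by simp
    with \<open>k \<ge> 1\<close> l(2) show False by (auto simp: root_of_unity_def)
  qed
  have key: "(g oo f = fps_const l * g) \<longleftrightarrow>
      (\<forall>n\<ge>2. g $ n = (\<Sum>i\<in>{..<n}. g $ i * (f ^ i) $ n) / (l - l ^ n))"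
    if g: "g $ 0 = 0" "g $ 1 = 1" for g
  proof -
    have "(g oo f) $ n = l * g $ n \<longleftrightarrow>
        (n \<ge> 2 \<longrightarrow> g $ n = (\<Sum>i\<in>{..<n}. g $ i * (f ^ i) $ n) / (l - l ^ n))" for n
    proof -
      consider "n = 0" | "n = 1" | "n \<ge> 2" by linarith
      then show ?thesis
      proof cases
        case 3
        have "(g oo f) $ n = l * g $ n \<longleftrightarrow>
            (\<Sum>i\<in>{..<n}. g $ i * (f ^ i) $ n) = g $ n * (l - l ^ n)"
          unfolding comp by (auto simp: algebra_simps)
        then show ?thesis using ne[OF 3] 3 by (auto simp: field_simps)
      qed (use g comp[of g 0] comp[of g 1] in auto)
    qed
    then show ?thesis by (auto simp: fps_eq_iff)
  qed
  show ?thesis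
  proof (rule ex1I)
    let ?g = "Abs_fps (conjugacy_coeff l f)"
    have g: "?g $ 0 = 0" "?g $ 1 = 1" by (simp_all add: conjugacy_coeff.simps)
    moreover have "?g $ n = (\<Sum>i\<in>{..<n}. ?g $ i * (f ^ i) $ n) / (l - l ^ n)" if "n \<ge> 2" for n
      using that by (simp add: conjugacy_coeff.simps[of l f n])
    ultimately show "is_conjugacy l f ?g" using key[OF g] by (simp add: is_conjugacy_def)
  next
    fix g assume "is_conjugacy l f g"
    then have g: "g $ 0 = 0" "g $ 1 = 1" and eq: "g oo f = fps_const l * g"
      by (auto simp: is_conjugacy_def)
    have "g $ n = conjugacy_coeff l f n" for n
    proof (induction n rule: less_induct)
      case (less n)
      consider "n = 0" | "n = 1" | "n \<ge> 2" by linarith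
      then show ?case
      proof cases
        case 3
        then have "g $ n = (\<Sum>i\<in>{..<n}. g $ i * (f ^ i) $ n) / (l - l ^ n)"
          using key[OF g] eq by blast
        also have "\<dots> = conjugacy_coeff l f n"
          using 3 less by (simp add: conjugacy_coeff.simps[of l f n])
        finally show ?thesis .
      qed (use g in \<open>simp_all add: conjugacy_coeff.simps\<close>)
    qed
    then show "g = Abs_fps (conjugacy_coeff l f)" by (simp add: fps_eq_iff)
  qed
qed

definition ps_converges :: "'a::abs_valued_field fps \<Rightarrow> 'a \<Rightarrow> bool" where
  "ps_converges f x \<longleftrightarrow> summable (\<lambda>n. f $ n * x ^ n)"

definition ps_eval :: "'a::abs_valued_field fps \<Rightarrow> 'a \<Rightarrow> 'a" where
  "ps_eval f x = (\<Sum>n. f $ n * x ^ n)"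

text \<open>
  Since \<^const>\<open>suminf\<close> is total, convergence is required at every point where a power series is
  evaluated, including the inner values of compositions.
\<close>

definition semi_conjugacy_on :: "'a::abs_valued_field set \<Rightarrow> 'a \<Rightarrow> 'a fps \<Rightarrow> 'a fps \<Rightarrow> bool" where
  "semi_conjugacy_on V l f g \<longleftrightarrow>
     (\<forall>x\<in>V. ps_converges g x \<and> ps_converges f x \<and> ps_converges g (ps_eval f x)
        \<and> ps_eval g (ps_eval f x) = l * ps_eval g x)"

definition full_conjugacy_on :: "'a::abs_valued_field set \<Rightarrow> 'a \<Rightarrow> 'a fps \<Rightarrow> 'a fps \<Rightarrow> bool" where
  "full_conjugacy_on U l f g \<longleftrightarrow>
     (\<forall>x\<in>U. ps_converges g x) \<and> inj_on (ps_eval g) U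
     \<and> (\<forall>x\<in>U. ps_converges (fps_inv g) x
        \<and> ps_converges f (ps_eval (fps_inv g) x)
        \<and> ps_converges g (ps_eval f (ps_eval (fps_inv g) x))
        \<and> ps_eval g (ps_eval f (ps_eval (fps_inv g) x)) = l * x)"

end

theory Submission
  imports Defs
begin

text \<open>
  Write \<open>m = m_of l\<close>, \<open>k' = k'_of l\<close> and \<open>\<delta> = \<bar>1 - l ^ m\<bar>\<close>, so that \<open>0 < \<delta> < 1\<close>. Comparing coefficients in
  \<open>g oo f = l * g\<close> gives the recursion
  \<open>g\<^sub>n * (l - l ^ n) = \<Sum> g\<^sub>i * (f ^ i)\<^sub>n\<close> with the sum over \<open>i < n\<close>, and the question is how often the divisor
  \<open>l - l ^ n\<close> is small.

  All exponents of \<open>f\<close> except the first are multiples of \<open>p\<close>, and \<open>g\<close> inherits this shape because \<open>p\<close>-th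
  powers have vanishing derivative (\<open>conjugacy_support\<close>). So only indices \<open>n\<close> divisible by \<open>p\<close> matter. For
  them \<open>p\<close> does not divide \<open>n - 1\<close>, and therefore \<open>\<bar>l - l ^ n\<bar>\<close> equals \<open>\<delta>\<close> if \<open>m\<close> divides \<open>n - 1\<close>, and is at
  least 1 otherwise (\<open>abs_val_divisor_eq\<close>, \<open>abs_val_divisor_ge_1\<close>). As \<open>p\<close> does not divide \<open>m\<close>, the indices
  with a small divisor form the progression \<open>k', k' + m * p, \<dots>\<close> (\<open>k'_of_props\<close>). With \<open>N n\<close> the number of its
  members up to \<open>n\<close>, the ultrametric inequality yields \<open>\<bar>g\<^sub>n\<bar> \<le> a ^ (n - 1) * \<delta> ^ (- N n)\<close>
  (\<open>conjugacy_coeff_bound\<close>).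

  Two affine bounds on \<open>N\<close> give the two radii. From \<open>N n \<le> 1 + n / (m * p)\<close> the series \<open>g\<close> converges on the
  disc of radius \<open>\<rho>\<close>; since \<open>\<rho> \<le> 1 / a\<close>, also \<open>f\<close> converges there and maps the disc into itself, and the
  formal identity may be evaluated (\<open>ps_eval_compose\<close>). From \<open>k' \<le> m * p\<close> one gets
  \<open>N n \<le> (n - 1) / (k' - 1)\<close>, that is \<open>\<bar>g\<^sub>n\<bar> \<le> \<sigma> ^ (1 - n)\<close>. Series with leading term \<open>x\<close> and this bound are
  closed under compositional inversion (\<open>geom_bounded_fps_inv\<close>) and map the disc of radius \<open>\<sigma>\<close> into
  itself, so \<open>g\<close> and its inverse are mutually inverse bijections of this disc, which lies in the disc of
  radius \<open>\<rho>\<close>.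
\<close>

section \<open>Absolute values in positive characteristic\<close>

lemma abs_val_0 [simp]: "abs_val (0::'a::abs_valued_field) = 0"
  by (simp add: abs_val_eq_zero)

lemma abs_val_1 [simp]: "abs_val (1::'a::abs_valued_field) = 1"
  using abs_val_mult[of "1::'a" 1] abs_val_eq_zero[of "1::'a"] by simp

lemma abs_val_minus [simp]: "abs_val (- x) = abs_val (x::'a::abs_valued_field)"
proof -
  have "abs_val (- 1 :: 'a) ^ 2 = 1"
    using abs_val_mult[of "- 1 :: 'a" "- 1"] by (simp add: power2_eq_square)
  then have "abs_val (- 1 :: 'a) = 1"
    using abs_val_nonneg[of "- 1 :: 'a"] by (simp add: power2_eq_1_iff)
  then show ?thesis using abs_val_mult[of "- 1" x] by simp
qed

lemma abs_val_minus_commute: "abs_val (x - y) = abs_val (y - x :: 'a::abs_valued_field)"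
  using abs_val_minus[of "x - y"] by simp

lemma abs_val_power: "abs_val (x ^ n) = abs_val (x::'a::abs_valued_field) ^ n"
  by (induction n) (simp_all add: abs_val_mult)

lemma abs_val_conv_dist: "abs_val x = dist x (0::'a::abs_valued_field)"
  by (simp add: dist_abs_val)

lemma tendsto_abs_val:
  "(f \<longlongrightarrow> L) F \<Longrightarrow> ((\<lambda>x. abs_val (f x)) \<longlongrightarrow> abs_val (L::'a::abs_valued_field)) F"
  unfolding abs_val_conv_dist by (intro tendsto_intros)

lemma tendsto_abs_val_iff:
  "(f \<longlongrightarrow> L) F \<longleftrightarrow> ((\<lambda>x. abs_val (f x - (L::'a::abs_valued_field))) \<longlongrightarrow> 0) F"
  by (subst tendsto_dist_iff) (simp add: dist_abs_val)

text \<open>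
  The field operations are continuous for the metric of the absolute value. Recording this as class
  inclusions makes the general limit and series lemmas applicable.
\<close>

instance abs_valued_field \<subseteq> topological_ab_group_add
proof
  fix a b :: 'a
  have fst: "((\<lambda>x. abs_val (fst x - a)) \<longlongrightarrow> 0) (nhds a \<times>\<^sub>F nhds b)"
    and snd: "((\<lambda>x. abs_val (snd x - b)) \<longlongrightarrow> 0) (nhds a \<times>\<^sub>F nhds b)"
    using tendsto_fst[OF filterlim_ident, of "(a, b)"] tendsto_snd[OF filterlim_ident, of "(a, b)"]
    by (simp_all add: nhds_prod flip: tendsto_abs_val_iff)
  show "((\<lambda>x. fst x + snd x) \<longlongrightarrow> a + b) (nhds a \<times>\<^sub>F nhds b)"
  proof (subst tendsto_abs_val_iff, rule tendsto_sandwich[OF _ _ tendsto_const])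
    show "((\<lambda>x. abs_val (fst x - a) + abs_val (snd x - b)) \<longlongrightarrow> 0) (nhds a \<times>\<^sub>F nhds b)"
      using tendsto_add[OF fst snd] by simp
    have "abs_val (fst x + snd x - (a + b)) \<le> abs_val (fst x - a) + abs_val (snd x - b)"
      for x :: "'a \<times> 'a"
      using abs_val_triangle[of "fst x - a" "snd x - b"] by (simp add: algebra_simps)
    then show "\<forall>\<^sub>F x in nhds a \<times>\<^sub>F nhds b. abs_val (fst x + snd x - (a + b))
        \<le> abs_val (fst x - a) + abs_val (snd x - b)"
      by simp
  qed (simp add: abs_val_nonneg)
next
  fix a :: 'a
  have "((\<lambda>x. abs_val (x - a)) \<longlongrightarrow> 0) (nhds a)"
    using tendsto_abs_val_iff[of "\<lambda>x. x" a "nhds a"] by (simp add: filterlim_ident)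
  moreover have "abs_val (- x - - a) = abs_val (x - a)" for x
    using abs_val_minus_commute[of a x] by simp
  ultimately show "(uminus \<longlongrightarrow> - a) (nhds a)"
    by (subst tendsto_abs_val_iff) (simp only:)
qed

instance abs_valued_field \<subseteq> topological_semigroup_mult
proof
  fix a b :: 'a
  let ?F = "nhds a \<times>\<^sub>F nhds b"
  have fst: "((\<lambda>x. abs_val (fst x - a)) \<longlongrightarrow> 0) ?F"
    and snd: "((\<lambda>x. abs_val (snd x - b)) \<longlongrightarrow> 0) ?F"
    using tendsto_fst[OF filterlim_ident, of "(a, b)"] tendsto_snd[OF filterlim_ident, of "(a, b)"]
    by (simp_all add: nhds_prod flip: tendsto_abs_val_iff)
  have sndb: "((\<lambda>x. abs_val (snd x)) \<longlongrightarrow> abs_val b) ?F"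
    using tendsto_snd[OF filterlim_ident, of "(a, b)"] by (simp add: nhds_prod tendsto_abs_val)
  show "((\<lambda>x. fst x * snd x) \<longlongrightarrow> a * b) ?F"
  proof (subst tendsto_abs_val_iff, rule tendsto_sandwich[OF _ _ tendsto_const])
    show "((\<lambda>x. abs_val (fst x - a) * abs_val (snd x) + abs_val a * abs_val (snd x - b)) \<longlongrightarrow> 0) ?F"
      using tendsto_add[OF tendsto_mult[OF fst sndb] tendsto_mult[OF tendsto_const snd]] by simp
    have "abs_val (fst x * snd x - a * b)
        \<le> abs_val (fst x - a) * abs_val (snd x) + abs_val a * abs_val (snd x - b)"
      for x :: "'a \<times> 'a"
      using abs_val_triangle[of "(fst x - a) * snd x" "a * (snd x - b)"]
      by (simp add: algebra_simps flip: abs_val_mult)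
    then show "\<forall>\<^sub>F x in ?F. abs_val (fst x * snd x - a * b)
        \<le> abs_val (fst x - a) * abs_val (snd x) + abs_val a * abs_val (snd x - b)"
      by simp
  qed (simp add: abs_val_nonneg)
qed

text \<open>
  In characteristic \<open>p > 0\<close> the Frobenius map is additive, so
  \<open>\<bar>x + y\<bar> ^ q \<le> \<bar>x\<bar> ^ q + \<bar>y\<bar> ^ q \<le> 2 * M ^ q\<close> for every power \<open>q\<close> of \<open>p\<close>. Taking \<open>q\<close>-th roots and
  letting \<open>q\<close> grow removes the factor 2.
\<close>

lemma abs_val_ultrametric:
  fixes x y :: "'a::abs_valued_field"
  assumes char: "CHAR('a) > 0" and x: "abs_val x \<le> M" and y: "abs_val y \<le> M"
  shows "abs_val (x + y) \<le> M"
proof (rule ccontr)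
  assume "\<not> ?thesis"
  then have gt: "M < abs_val (x + y)" by simp
  have M: "M > 0"
  proof (rule ccontr)
    assume "\<not> M > 0"
    with x y abs_val_nonneg[of x] abs_val_nonneg[of y] have "x = 0" "y = 0"
      by (auto simp flip: abs_val_eq_zero)
    with gt x show False by simp
  qed
  define r where "r = abs_val (x + y) / M"
  have r: "r > 1" using gt M by (simp add: r_def)
  have p: "prime CHAR('a)" using char by (rule prime_CHAR_semidom)
  obtain n where n: "2 < r ^ n" using real_arch_pow[OF r] by blast
  define q where "q = CHAR('a) ^ n"
  have "n \<le> q" unfolding q_def using prime_ge_2_nat[OF p]
    by (meson less_imp_le order_trans less_exp power_mono zero_le)
  \<comment> \<open>The binomial formula degenerates to two terms, so the factor lost in the triangle
    inequality stays 2 while the exponent grows.\<close>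
  have "abs_val (x + y) ^ q = abs_val (x ^ q + y ^ q)"
    using freshmans_dream'[OF p q_def] by (simp flip: abs_val_power)
  also have "\<dots> \<le> abs_val x ^ q + abs_val y ^ q"
    using abs_val_triangle[of "x ^ q" "y ^ q"] by (simp add: abs_val_power)
  also have "\<dots> \<le> M ^ q + M ^ q"
    using x y by (intro add_mono power_mono abs_val_nonneg)
  finally have "r ^ q \<le> 2"
    using M by (simp add: r_def power_divide field_simps)
  moreover have "r ^ n \<le> r ^ q" using r \<open>n \<le> q\<close> by (intro power_increasing) auto
  ultimately show False using n by linarith
qed

lemma abs_val_ultrametric_diff:
  fixes x y :: "'a::abs_valued_field"
  assumes "CHAR('a) > 0" "abs_val x \<le> M" "abs_val y \<le> M"
  shows "abs_val (x - y) \<le> M"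
  using abs_val_ultrametric[of x M "- y"] assms by simp

lemma abs_val_sum_le:
  fixes f :: "'b \<Rightarrow> 'a::abs_valued_field"
  assumes char: "CHAR('a) > 0" and M: "0 \<le> M" and f: "\<And>i. i \<in> I \<Longrightarrow> abs_val (f i) \<le> M"
  shows "abs_val (sum f I) \<le> M"
  using f by (induction I rule: infinite_finite_induct) (auto simp: M intro!: abs_val_ultrametric[OF char])

lemma abs_val_eq_if_close:
  fixes x y :: "'a::abs_valued_field"
  assumes char: "CHAR('a) > 0" and lt: "abs_val (x - y) < abs_val y"
  shows "abs_val x = abs_val y"
proof (rule antisym)
  show "abs_val x \<le> abs_val y"
    using abs_val_ultrametric[OF char, of "x - y" "abs_val y" y] lt by simp
  show "abs_val y \<le> abs_val x"
  proof (rule ccontr)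
    assume "\<not> ?thesis"
    then have "abs_val y \<le> max (abs_val x) (abs_val (x - y))"
      using abs_val_ultrametric_diff[OF char, of x "max (abs_val x) (abs_val (x - y))" "x - y"] by simp
    with \<open>\<not> ?thesis\<close> lt show False by simp
  qed
qed

section \<open>Geometrically bounded power series and their evaluation\<close>

text \<open>
  This says that the Gauss norm of \<open>u\<close> for the radius \<open>1 / b\<close> is at most \<open>A\<close>. A formulation by the
  inequality instead of a supremum needs no finiteness side conditions. The case \<open>A = 1 / b\<close>, that is
  \<open>\<bar>u\<^sub>n\<bar> \<le> b ^ (n - 1)\<close>, is for series without constant term the one that is stable under composition.
\<close>

definition geom_bounded :: "real \<Rightarrow> real \<Rightarrow> 'a::abs_valued_field fps \<Rightarrow> bool" where
  "geom_bounded A b u \<longleftrightarrow> (\<forall>n. abs_val (u $ n) \<le> A * b ^ n)"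

lemma geom_bounded_nonneg: "geom_bounded A b u \<Longrightarrow> 0 \<le> A"
  using order_trans[OF abs_val_nonneg] by (fastforce simp: geom_bounded_def dest: spec[of _ 0])

text \<open>
  Every term of the Cauchy product satisfies the bound and, by the ultrametric inequality, so does
  their sum: the Gauss norm is submultiplicative.
\<close>

lemma geom_bounded_mult:
  fixes u v :: "'a::abs_valued_field fps"
  assumes char: "CHAR('a) > 0" and b: "0 \<le> b"
    and u: "geom_bounded A b u" and v: "geom_bounded B b v"
  shows "geom_bounded (A * B) b (u * v)"
  unfolding geom_bounded_def fps_mult_nth
proof (intro allI abs_val_sum_le[OF char])
  have AB: "0 \<le> A" "0 \<le> B" using u v by (auto dest: geom_bounded_nonneg)
  then show "0 \<le> A * B * b ^ n" for n using b by simp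
  fix n i :: nat assume "i \<in> {0..n}"
  then have "b ^ n = b ^ i * b ^ (n - i)" by (simp flip: power_add)
  then show "abs_val (u $ i * v $ (n - i)) \<le> A * B * b ^ n"
    using mult_mono[of "abs_val (u $ i)" "A * b ^ i" "abs_val (v $ (n - i))" "B * b ^ (n - i)"]
      u v AB b by (simp add: geom_bounded_def abs_val_mult abs_val_nonneg mult_ac)
qed

lemma geom_bounded_power:
  fixes u :: "'a::abs_valued_field fps"
  assumes char: "CHAR('a) > 0" and b: "0 \<le> b" and u: "geom_bounded A b u"
  shows "geom_bounded (A ^ l) b (u ^ l)"
proof (induction l)
  case 0
  then show ?case using b by (simp add: geom_bounded_def fps_one_nth)
next
  case (Suc l)
  then show ?case using geom_bounded_mult[OF char b u] by simp
qed

lemma abs_val_term_le: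
  assumes "geom_bounded A b u"
  shows "abs_val (u $ n * x ^ n) \<le> A * (b * abs_val x) ^ n"
  using assms mult_right_mono[of "abs_val (u $ n)" "A * b ^ n" "abs_val x ^ n"]
  by (simp add: geom_bounded_def abs_val_mult abs_val_power power_mult_distrib mult_ac abs_val_nonneg)

text \<open>
  A block of consecutive terms is no larger than its largest term, so terms that tend to zero already
  make the partial sums a Cauchy sequence.
\<close>

lemma summable_ultrametric:
  fixes t :: "nat \<Rightarrow> 'a::{abs_valued_field, complete_space}"
  assumes char: "CHAR('a) > 0" and t: "(\<lambda>n. abs_val (t n)) \<longlonglongrightarrow> 0"
  shows "summable t"
proof -
  have "Cauchy (\<lambda>n. sum t {..<n})"
  proof (rule CauchyI')
    fix e :: real assume e: "e > 0"
    then obtain N where N: "\<And>n. n \<ge> N \<Longrightarrow> abs_val (t n) < e / 2"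
      using order_tendstoD(2)[OF t, of "e / 2"] by (auto simp: eventually_sequentially)
    show "\<exists>M. \<forall>m\<ge>M. \<forall>n>m. dist (sum t {..<m}) (sum t {..<n}) < e"
    proof (intro exI allI impI)
      fix m n assume mn: "m \<ge> N" "n > m"
      have "{..<n} - {..<m} = {m..<n}" by auto
      then have "sum t {..<n} - sum t {..<m} = sum t {m..<n}"
        using mn sum_diff[of "{..<n}" "{..<m}" t] by simp
      moreover have "abs_val (sum t {m..<n}) \<le> e / 2"
        using mn e N by (intro abs_val_sum_le[OF char]) (auto intro: less_imp_le)
      ultimately show "dist (sum t {..<m}) (sum t {..<n}) < e"
        using e abs_val_minus_commute[of "sum t {..<n}" "sum t {..<m}"] by (simp add: dist_abs_val)
    qed
  qed
  then show ?thesis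
    by (auto simp: summable_iff_convergent intro: Cauchy_convergent)
qed

lemma abs_val_sums_le:
  fixes t :: "nat \<Rightarrow> 'a::abs_valued_field"
  assumes char: "CHAR('a) > 0" and s: "t sums s" and M: "0 \<le> M" "\<And>n. abs_val (t n) \<le> M"
  shows "abs_val s \<le> M"
proof (rule tendsto_upperbound)
  show "(\<lambda>n. abs_val (sum t {..<n})) \<longlonglongrightarrow> abs_val s"
    using s by (auto simp: sums_def intro: tendsto_abs_val)
  show "\<forall>\<^sub>F n in sequentially. abs_val (sum t {..<n}) \<le> M"
    using M by (intro always_eventually allI abs_val_sum_le[OF char])
qed simp

lemma sums_mult_abs_valued:
  "t sums s \<Longrightarrow> (\<lambda>n. k * t n) sums (k * s :: 'a::abs_valued_field)"
  unfolding sums_def sum_distrib_left[symmetric] by (intro tendsto_mult tendsto_const)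

lemma abs_val_tendsto_zero:
  assumes "\<And>n. abs_val (t n) \<le> h n" "h \<longlonglongrightarrow> 0"
  shows "(\<lambda>n. abs_val (t n :: 'a::abs_valued_field)) \<longlonglongrightarrow> 0"
  by (rule tendsto_sandwich[OF _ _ tendsto_const assms(2)]) (simp_all add: assms(1) abs_val_nonneg)

lemma geometric_tendsto_zero:
  "0 \<le> q \<Longrightarrow> q < 1 \<Longrightarrow> (\<lambda>n. C * q ^ n) \<longlonglongrightarrow> (0::real)"
  by (rule tendsto_mult_right_zero, rule LIMSEQ_power_zero) simp

lemma ps_eval_sums:
  fixes u :: "'a::{abs_valued_field, complete_space} fps"
  assumes char: "CHAR('a) > 0" and b: "0 \<le> b" "b * abs_val x < 1" and u: "geom_bounded A b u"
  shows "(\<lambda>n. u $ n * x ^ n) sums ps_eval u x"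
proof -
  have "(\<lambda>n. A * (b * abs_val x) ^ n) \<longlonglongrightarrow> 0"
    using b by (intro geometric_tendsto_zero) (simp_all add: abs_val_nonneg)
  then have "(\<lambda>n. abs_val (u $ n * x ^ n)) \<longlonglongrightarrow> 0"
    by (rule abs_val_tendsto_zero[OF abs_val_term_le[OF u]])
  from summable_ultrametric[OF char this] show ?thesis
    by (simp add: ps_eval_def summable_sums)
qed

lemma ps_converges_geom_bounded:
  fixes u :: "'a::{abs_valued_field, complete_space} fps"
  assumes "CHAR('a) > 0" "0 \<le> b" "b * abs_val x < 1" "geom_bounded A b u"
  shows "ps_converges u x"
  using ps_eval_sums[OF assms] by (auto simp: ps_converges_def sums_iff)

lemma ps_eval_mult:
  fixes u v :: "'a::{abs_valued_field, complete_space} fps"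
  assumes char: "CHAR('a) > 0" and b: "0 \<le> b" "b * abs_val x < 1"
    and u: "geom_bounded A b u" and v: "geom_bounded B b v"
  shows "ps_eval (u * v) x = ps_eval u x * ps_eval v x"
proof -
  define q where "q = b * abs_val x"
  define U where "U = (\<lambda>n. u $ n * x ^ n)"
  define V where "V = (\<lambda>n. v $ n * x ^ n)"
  define W where "W = (\<lambda>n. (u * v) $ n * x ^ n)"
  have q: "0 \<le> q" "q < 1" using b by (auto simp: q_def abs_val_nonneg)
  have AB: "0 \<le> A" "0 \<le> B" using u v by (auto dest: geom_bounded_nonneg)
  have W: "W k = (\<Sum>i\<le>k. U i * V (k - i))" for k
    unfolding W_def U_def V_def fps_mult_nth sum_distrib_right atLeast0AtMost
  proof (intro sum.cong refl)
    fix i assume "i \<in> {..k}"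
    then have "x ^ k = x ^ i * x ^ (k - i)" by (simp flip: power_add)
    then show "u $ i * v $ (k - i) * x ^ k = u $ i * x ^ i * (v $ (k - i) * x ^ (k - i))"
      by simp
  qed
  \<comment> \<open>The square of index pairs exceeds the triangle by pairs of total degree at least \<open>n\<close>.\<close>
  have diff: "abs_val (sum U {..<n} * sum V {..<n} - sum W {..<n}) \<le> A * B * q ^ n" for n
  proof -
    define T where "T = {(i, j). i + j < n}"
    have "sum U {..<n} * sum V {..<n} = (\<Sum>(i,j)\<in>{..<n} \<times> {..<n}. U i * V j)"
      by (simp add: sum_product sum.cartesian_product)
    moreover have "sum W {..<n} = (\<Sum>(i,j)\<in>T. U i * V j)"
      by (simp add: W sum.triangle_reindex T_def)
    moreover have "T \<subseteq> {..<n} \<times> {..<n}" by (auto simp: T_def)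
    ultimately have "sum U {..<n} * sum V {..<n} - sum W {..<n}
        = (\<Sum>(i,j)\<in>{..<n} \<times> {..<n} - T. U i * V j)"
      by (simp add: sum_diff)
    also have "abs_val \<dots> \<le> A * B * q ^ n"
    proof (rule abs_val_sum_le[OF char])
      show "0 \<le> A * B * q ^ n" using AB q by simp
      fix ij assume "ij \<in> {..<n} \<times> {..<n} - T"
      then obtain i j where ij: "ij = (i, j)" "n \<le> i + j" by (auto simp: T_def)
      have "abs_val (U i * V j) \<le> (A * q ^ i) * (B * q ^ j)"
        unfolding abs_val_mult U_def V_def q_def using AB b
        by (intro mult_mono[OF abs_val_term_le[OF u, of i x, unfolded abs_val_mult]
            abs_val_term_le[OF v, of j x, unfolded abs_val_mult]])
          (auto simp: abs_val_nonneg)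
      also have "\<dots> = A * B * q ^ (i + j)" by (simp add: power_add mult_ac)
      also have "\<dots> \<le> A * B * q ^ n"
        using ij q AB by (intro mult_left_mono power_decreasing) auto
      finally show "abs_val (case ij of (i, j) \<Rightarrow> U i * V j) \<le> A * B * q ^ n"
        by (simp add: ij)
    qed
    finally show ?thesis .
  qed
  have "(\<lambda>n. A * B * q ^ n) \<longlonglongrightarrow> 0"
    using q by (rule geometric_tendsto_zero)
  then have "(\<lambda>n. abs_val (sum U {..<n} * sum V {..<n} - sum W {..<n} - 0)) \<longlonglongrightarrow> 0"
    by (intro abs_val_tendsto_zero) (simp_all add: diff)
  then have "(\<lambda>n. sum U {..<n} * sum V {..<n} - sum W {..<n}) \<longlonglongrightarrow> 0"
    by (subst tendsto_abs_val_iff)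
  moreover have "(\<lambda>n. sum U {..<n} * sum V {..<n} - sum W {..<n})
      \<longlonglongrightarrow> ps_eval u x * ps_eval v x - ps_eval (u * v) x"
    using ps_eval_sums[OF char b u] ps_eval_sums[OF char b v]
      ps_eval_sums[OF char b geom_bounded_mult[OF char b(1) u v]]
    unfolding sums_def U_def V_def W_def by (intro tendsto_diff tendsto_mult)
  ultimately show ?thesis
    using LIMSEQ_unique by fastforce
qed

lemma ps_eval_1 [simp]: "ps_eval 1 x = 1"
proof -
  have "(\<lambda>n. (1::'a fps) $ n * x ^ n) = (\<lambda>n. if n = 0 then 1 else 0)"
    by (auto simp: fps_one_nth)
  then have "(\<lambda>n. (1::'a fps) $ n * x ^ n) sums 1"
    using sums_single[of 0 "\<lambda>_. 1::'a"] by simp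
  then show ?thesis by (simp add: ps_eval_def sums_iff)
qed

lemma ps_eval_fps_X [simp]: "ps_eval fps_X x = (x :: 'a::abs_valued_field)"
proof -
  have "(\<lambda>n. (fps_X :: 'a fps) $ n * x ^ n) = (\<lambda>n. if n = 1 then x else 0)"
    by auto
  then have "(\<lambda>n. (fps_X :: 'a fps) $ n * x ^ n) sums x"
    using sums_single[of 1 "\<lambda>_. x"] by simp
  then show ?thesis by (simp add: ps_eval_def sums_iff)
qed

lemma ps_eval_fps_const_mult:
  fixes u :: "'a::{abs_valued_field, complete_space} fps"
  assumes char: "CHAR('a) > 0" and b: "0 \<le> b" "b * abs_val x < 1" and u: "geom_bounded A b u"
  shows "ps_eval (fps_const k * u) x = k * ps_eval u x"
proof -
  have "(\<lambda>n. (fps_const k * u) $ n * x ^ n) sums (k * ps_eval u x)"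
    using sums_mult_abs_valued[OF ps_eval_sums[OF char b u], of k] by (simp add: mult.assoc)
  then show ?thesis by (simp add: ps_eval_def[of "fps_const k * u"] sums_iff)
qed

lemma ps_eval_power:
  fixes u :: "'a::{abs_valued_field, complete_space} fps"
  assumes char: "CHAR('a) > 0" and b: "0 \<le> b" "b * abs_val x < 1" and u: "geom_bounded A b u"
  shows "ps_eval (u ^ l) x = ps_eval u x ^ l"
proof (induction l)
  case (Suc l)
  then show ?case
    using ps_eval_mult[OF char b u geom_bounded_power[OF char b(1) u]] by simp
qed simp

text \<open>
  Inside the disc of radius \<open>1 / b\<close> the linear term of such a series dominates all others.
\<close>

lemma abs_val_ps_eval_le:
  fixes u :: "'a::{abs_valued_field, complete_space} fps"
  assumes char: "CHAR('a) > 0" and b: "0 < b" "b * abs_val x < 1"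
    and u0: "u $ 0 = 0" and u: "geom_bounded (1 / b) b u"
  shows "abs_val (ps_eval u x) \<le> abs_val x"
proof (rule abs_val_sums_le[OF char ps_eval_sums[OF char less_imp_le[OF b(1)] b(2) u]])
  fix n
  show "abs_val (u $ n * x ^ n) \<le> abs_val x"
  proof (cases n)
    case 0
    then show ?thesis by (simp add: u0 abs_val_nonneg)
  next
    case (Suc k)
    have "abs_val (u $ n * x ^ n) \<le> 1 / b * (b * abs_val x) ^ n"
      by (rule abs_val_term_le[OF u])
    also have "\<dots> = abs_val x * (b * abs_val x) ^ k" using b by (simp add: Suc)
    also have "\<dots> \<le> abs_val x * 1"
      using b by (intro mult_left_mono power_le_one) (auto simp: abs_val_nonneg)
    finally show ?thesis by simp
  qed
qed (simp add: abs_val_nonneg)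

text \<open>
  Evaluation at a point is a ring homomorphism and hence respects substitution into polynomials; the
  estimate of the remainder carries this over to the series \<open>g\<close>. The hypothesis \<open>b \<le> c\<close> ensures that \<open>u\<close>
  maps the disc of radius \<open>1 / c\<close> into itself.
\<close>

lemma ps_eval_compose:
  fixes g u :: "'a::{abs_valued_field, complete_space} fps"
  assumes char: "CHAR('a) > 0" and b: "0 < b" "b \<le> c" and x: "c * abs_val x < 1"
    and u0: "u $ 0 = 0" and u: "geom_bounded (1 / b) b u" and g: "geom_bounded C c g"
  shows "ps_eval g (ps_eval u x) = ps_eval (g oo u) x"
proof -
  define q where "q = c * abs_val x"
  have c: "0 < c" using b by simp
  have q: "0 \<le> q" "q < 1" using x c by (auto simp: q_def abs_val_nonneg)
  have bx: "b * abs_val x < 1"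
    using x mult_right_mono[OF b(2) abs_val_nonneg[of x]] by simp
  have C: "0 \<le> C" using g by (rule geom_bounded_nonneg)
  have coeff_le: "abs_val (g $ l * (u ^ l) $ n) \<le> C * c ^ n" for l n
  proof (cases "l \<le> n")
    case True
    have "abs_val ((u ^ l) $ n) \<le> (1 / b) ^ l * b ^ n"
      using geom_bounded_power[OF char _ u] b by (simp add: geom_bounded_def)
    also have "\<dots> = b ^ (n - l)" using True b by (simp add: power_diff power_divide)
    also have "\<dots> \<le> c ^ (n - l)" using b by (intro power_mono) auto
    finally have "abs_val (g $ l * (u ^ l) $ n) \<le> (C * c ^ l) * c ^ (n - l)"
      unfolding abs_val_mult using g C c
      by (intro mult_mono) (auto simp: geom_bounded_def abs_val_nonneg)
    also have "\<dots> = C * c ^ n" using True by (simp flip: power_add)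
    finally show ?thesis .
  next
    case False
    then show ?thesis using C c startsby_zero_power_prefix[OF u0, of l] by simp
  qed
  have gu: "geom_bounded C c (g oo u)"
    unfolding geom_bounded_def fps_compose_nth using C c coeff_le
    by (intro allI abs_val_sum_le[OF char]) auto
  \<comment> \<open>Removing the first \<open>N\<close> terms of \<open>g\<close> leaves a series in \<open>u\<close> whose coefficients still obey the
    same bound and vanish below degree \<open>N\<close>.\<close>
  have diff: "abs_val (ps_eval (g oo u) x - (\<Sum>l<N. g $ l * ps_eval u x ^ l)) \<le> C * q ^ N" for N
  proof -
    let ?t = "\<lambda>n. (g oo u) $ n * x ^ n - (\<Sum>l<N. g $ l * ((u ^ l) $ n * x ^ n))"
    have tail: "?t n = (\<Sum>l\<in>{N..n}. g $ l * (u ^ l) $ n) * x ^ n" for n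
    proof -
      let ?F = "\<lambda>l. g $ l * (u ^ l) $ n"
      have "sum ?F {..<N} = sum ?F ({..<N} \<inter> {0..n})"
      proof (intro sum.mono_neutral_right ballI)
        fix l assume "l \<in> {..<N} - {..<N} \<inter> {0..n}"
        then have "n < l" by auto
        then show "g $ l * (u ^ l) $ n = 0" using startsby_zero_power_prefix[OF u0, of l] by simp
      qed auto
      moreover have "sum ?F {0..n} = sum ?F (({..<N} \<inter> {0..n}) \<union> {N..n})"
        by (rule arg_cong[where f = "sum ?F"]) auto
      moreover have "\<dots> = sum ?F ({..<N} \<inter> {0..n}) + sum ?F {N..n}"
        by (rule sum.union_disjoint) auto
      moreover have "(\<Sum>l<N. g $ l * ((u ^ l) $ n * x ^ n)) = sum ?F {..<N} * x ^ n"
        by (simp only: sum_distrib_right mult.assoc)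
      ultimately show ?thesis
        by (simp only: fps_compose_nth left_diff_distrib[symmetric] add_diff_cancel_left')
    qed
    have "(\<lambda>n. \<Sum>l<N. g $ l * ((u ^ l) $ n * x ^ n)) sums (\<Sum>l<N. g $ l * ps_eval (u ^ l) x)"
    proof (intro sums_sum sums_mult_abs_valued)
      show "(\<lambda>n. (u ^ l) $ n * x ^ n) sums ps_eval (u ^ l) x" for l
        using b by (intro ps_eval_sums[OF char _ bx geom_bounded_power[OF char _ u]]) simp_all
    qed
    moreover have "(\<lambda>n. (g oo u) $ n * x ^ n) sums ps_eval (g oo u) x"
      using c by (intro ps_eval_sums[OF char _ x gu]) simp
    ultimately have sums: "?t sums (ps_eval (g oo u) x - (\<Sum>l<N. g $ l * ps_eval (u ^ l) x))"
      unfolding sums_def sum_subtractf by (intro tendsto_diff)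
    have "abs_val (?t n) \<le> C * q ^ N" for n
    proof (cases "N \<le> n")
      case True
      have "abs_val (?t n) \<le> (C * c ^ n) * abs_val x ^ n"
        unfolding tail abs_val_mult abs_val_power using C c coeff_le
        by (intro mult_right_mono abs_val_sum_le[OF char]) (auto simp: abs_val_nonneg)
      also have "\<dots> = C * q ^ n" by (simp add: q_def power_mult_distrib)
      also have "\<dots> \<le> C * q ^ N" using True q C by (intro mult_left_mono power_decreasing) auto
      finally show ?thesis .
    next
      case False
      then show ?thesis using C q by (simp add: tail)
    qed
    from abs_val_sums_le[OF char sums _ this]
    have "abs_val (ps_eval (g oo u) x - (\<Sum>l<N. g $ l * ps_eval (u ^ l) x)) \<le> C * q ^ N"
      using C q by simp
    then show ?thesis using ps_eval_power[OF char _ bx u] b by simp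
  qed
  have "(\<lambda>N. C * q ^ N) \<longlonglongrightarrow> 0"
    using q by (rule geometric_tendsto_zero)
  then have "(\<lambda>N. abs_val ((\<Sum>l<N. g $ l * ps_eval u x ^ l) - ps_eval (g oo u) x)) \<longlonglongrightarrow> 0"
    using diff
    by (intro abs_val_tendsto_zero[where h = "\<lambda>N. C * q ^ N"])
      (simp_all add: abs_val_minus_commute[of "sum _ _"])
  then have "(\<lambda>l. g $ l * ps_eval u x ^ l) sums ps_eval (g oo u) x"
    unfolding sums_def by (subst tendsto_abs_val_iff)
  then show ?thesis by (simp add: ps_eval_def[of g] sums_iff)
qed

section \<open>The size of the divisors\<close>

lemma abs_val_eq_one_if_close:
  fixes x :: "'a::abs_valued_field"
  assumes "CHAR('a) > 0" "abs_val (1 - x) < 1"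
  shows "abs_val x = 1"
  using abs_val_eq_if_close[of x 1] assms by (simp add: abs_val_minus_commute)

lemma abs_val_of_nat_le_one:
  assumes "CHAR('a::abs_valued_field) > 0"
  shows "abs_val (of_nat n :: 'a) \<le> 1"
  by (induction n) (auto intro!: abs_val_ultrametric[OF assms])

text \<open>
  An integer prime to \<open>p\<close> is invertible modulo \<open>p\<close>, and neither it nor its inverse has absolute value
  above one.
\<close>

lemma abs_val_of_nat_eq_one:
  assumes char: "CHAR('a::abs_valued_field) > 0" and n: "\<not> CHAR('a) dvd n"
  shows "abs_val (of_nat n :: 'a) = 1"
proof (rule antisym[OF abs_val_of_nat_le_one[OF char]])
  have "prime CHAR('a)" using char by (rule prime_CHAR_semidom)
  then have "gcd n CHAR('a) = 1"
    using n prime_imp_coprime[of "CHAR('a)" n] coprime_imp_gcd_eq_1[of "CHAR('a)" n]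
    by (simp add: gcd.commute)
  moreover have "n \<noteq> 0" using n by (metis dvd_0_right)
  ultimately obtain x y where "n * x = CHAR('a) * y + 1"
    using bezout_nat[of n "CHAR('a)"] by auto
  then have "of_nat (n * x) = (of_nat (CHAR('a) * y + 1) :: 'a)" by simp
  then have "abs_val (of_nat n :: 'a) * abs_val (of_nat x :: 'a) = 1"
    by (simp flip: abs_val_mult)
  then show "1 \<le> abs_val (of_nat n :: 'a)"
    using mult_left_mono[OF abs_val_of_nat_le_one[OF char, of x], of "abs_val (of_nat n :: 'a)"]
    by (simp add: abs_val_nonneg)
qed

lemma abs_val_one_minus_power_le:
  fixes x :: "'a::abs_valued_field"
  assumes char: "CHAR('a) > 0" and x: "abs_val x = 1"
  shows "abs_val (1 - x ^ n) \<le> abs_val (1 - x)"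
proof -
  have "abs_val (\<Sum>i<n. x ^ i) \<le> 1"
    by (intro abs_val_sum_le[OF char]) (simp_all add: abs_val_power x)
  then show ?thesis
    using mult_left_mono[of "abs_val (\<Sum>i<n. x ^ i)" 1 "abs_val (1 - x)"]
    by (simp add: one_diff_power_eq abs_val_mult abs_val_nonneg)
qed

text \<open>
  The quotient \<open>(1 - x ^ n) / (1 - x) = 1 + x + \<dots> + x ^ (n - 1)\<close> is congruent to \<open>n\<close> modulo the
  maximal ideal, hence a unit.
\<close>

lemma abs_val_one_minus_power_eq:
  fixes x :: "'a::abs_valued_field"
  assumes char: "CHAR('a) > 0" and x: "abs_val (1 - x) < 1" and n: "\<not> CHAR('a) dvd n"
  shows "abs_val (1 - x ^ n) = abs_val (1 - x)"
proof -
  have x1: "abs_val x = 1" by (rule abs_val_eq_one_if_close[OF char x])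
  have "(\<Sum>i<n. x ^ i) - of_nat n = (\<Sum>i<n. - (1 - x ^ i))"
    by (simp add: sum_subtractf)
  also have "abs_val \<dots> \<le> abs_val (1 - x)"
    using abs_val_one_minus_power_le[OF char x1]
    by (intro abs_val_sum_le[OF char abs_val_nonneg]) (simp only: abs_val_minus)
  finally have "abs_val (\<Sum>i<n. x ^ i) = 1"
    using abs_val_eq_if_close[OF char, of _ "of_nat n"] abs_val_of_nat_eq_one[OF char n] x by simp
  then show ?thesis by (simp add: one_diff_power_eq abs_val_mult)
qed

lemma m_of_props:
  assumes "m_exists l"
  shows m_of_ge_1: "m_of l \<ge> 1" and m_of_less_1: "abs_val (1 - l ^ m_of l) < 1"
    and m_of_le: "n \<ge> 1 \<Longrightarrow> abs_val (1 - l ^ n) < 1 \<Longrightarrow> m_of l \<le> n"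
proof -
  have "m_of l \<ge> 1 \<and> abs_val (1 - l ^ m_of l) < 1"
    unfolding m_of_def by (rule LeastI_ex) (use assms in \<open>simp add: m_exists_def\<close>)
  then show "m_of l \<ge> 1" "abs_val (1 - l ^ m_of l) < 1" by auto
  show "n \<ge> 1 \<Longrightarrow> abs_val (1 - l ^ n) < 1 \<Longrightarrow> m_of l \<le> n"
    unfolding m_of_def by (rule Least_le) simp
qed

lemma abs_val_divisor_pos:
  assumes "\<not> root_of_unity l" "m_exists l"
  shows "0 < abs_val (1 - l ^ m_of l)"
  using assms(1) m_of_ge_1[OF assms(2)] abs_val_nonneg[of "1 - l ^ m_of l"]
  by (auto simp: root_of_unity_def abs_val_eq_zero less_le)

lemma abs_val_multiplier:
  fixes l :: "'a::abs_valued_field"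
  assumes char: "CHAR('a) > 0" and l: "m_exists l"
  shows "abs_val l = 1"
proof -
  have "abs_val l ^ m_of l = 1"
    using abs_val_eq_one_if_close[OF char m_of_less_1[OF l]] by (simp add: abs_val_power)
  then show ?thesis
    using m_of_ge_1[OF l] abs_val_nonneg[of l] power_eq_imp_eq_base[of "abs_val l" "m_of l" 1] by simp
qed

text \<open>
  The residue class of \<open>l\<close> has multiplicative order \<open>m_of l\<close> in the residue field: dividing \<open>n\<close> by
  \<open>m_of l\<close> with remainder \<open>r > 0\<close> would otherwise make \<open>1 - l ^ r\<close> small.
\<close>

lemma abs_val_divisor_ge_1:
  fixes l :: "'a::abs_valued_field"
  assumes char: "CHAR('a) > 0" and l: "m_exists l" and n: "\<not> m_of l dvd n"
  shows "1 \<le> abs_val (1 - l ^ n)"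
proof (rule ccontr)
  assume "\<not> ?thesis"
  then have lt: "abs_val (1 - l ^ n) < 1" by simp
  let ?m = "m_of l" and ?r = "n mod m_of l"
  let ?y = "l ^ (m_of l * (n div m_of l))"
  have r: "?r \<ge> 1" using n by (simp add: dvd_eq_mod_eq_0)
  have "l ^ n = l ^ ?r * ?y" by (simp flip: power_add)
  then have eq: "1 - l ^ ?r = (1 - l ^ n) - l ^ ?r * (1 - ?y)" by (simp add: algebra_simps)
  have y: "abs_val (1 - ?y) < 1"
    unfolding power_mult
    by (rule order.strict_trans1[OF abs_val_one_minus_power_le[OF char
            abs_val_eq_one_if_close[OF char m_of_less_1[OF l]]] m_of_less_1[OF l]])
  define M where "M = max (abs_val (1 - l ^ n)) (abs_val (1 - ?y))"
  have "abs_val (1 - l ^ ?r) \<le> M"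
    unfolding eq M_def by (rule abs_val_ultrametric_diff[OF char])
      (simp_all add: abs_val_mult abs_val_power abs_val_multiplier[OF char l])
  also have "M < 1" using lt y by (simp add: M_def)
  finally have "?m \<le> ?r" using m_of_le[OF l r] by simp
  moreover have "?r < ?m" using m_of_ge_1[OF l] by simp
  ultimately show False by simp
qed

lemma abs_val_divisor_eq:
  fixes l :: "'a::abs_valued_field"
  assumes char: "CHAR('a) > 0" and l: "m_exists l" and n: "m_of l dvd n" "\<not> CHAR('a) dvd n"
  shows "abs_val (1 - l ^ n) = abs_val (1 - l ^ m_of l)"
proof -
  obtain k where k: "n = m_of l * k" using n(1) by auto
  then have "\<not> CHAR('a) dvd k" using n(2) by auto
  then show ?thesis
    using abs_val_one_minus_power_eq[OF char m_of_less_1[OF l]] by (simp add: k power_mult)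
qed

text \<open>
  If \<open>m = k * p\<close>, then \<open>1 - l ^ m = (1 - l ^ k) ^ p\<close>, so already \<open>1 - l ^ k\<close> would be small, contrary to
  minimality.
\<close>

lemma CHAR_not_dvd_m_of:
  fixes l :: "'a::abs_valued_field"
  assumes char: "CHAR('a) > 0" and l: "m_exists l"
  shows "\<not> CHAR('a) dvd m_of l"
proof
  assume "CHAR('a) dvd m_of l"
  then obtain k where k: "m_of l = k * CHAR('a)" by (metis dvd_def mult.commute)
  have p: "prime CHAR('a)" using char by (rule prime_CHAR_semidom)
  have k1: "k \<ge> 1" using k m_of_ge_1[OF l] by (cases k) auto
  have "(1 - l ^ k) ^ CHAR('a) = 1 - l ^ m_of l"
    using freshmans_dream[OF p refl, of "1 - l ^ k" "l ^ k"]
    by (simp add: k power_mult eq_diff_eq)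
  then have "abs_val (1 - l ^ k) ^ CHAR('a) < 1"
    using m_of_less_1[OF l] by (simp flip: abs_val_power)
  then have "abs_val (1 - l ^ k) < 1"
    using one_le_power[of "abs_val (1 - l ^ k)" "CHAR('a)"] by (meson not_le)
  then have "m_of l \<le> k" using m_of_le[OF l k1] by simp
  then show False using k k1 prime_ge_2_nat[OF p] by auto
qed

text \<open>
  Since \<open>p\<close> and \<open>m\<close> are coprime, the congruences \<open>n \<equiv> 0\<close> modulo \<open>p\<close> and \<open>n \<equiv> 1\<close> modulo \<open>m\<close> together
  define one residue class modulo \<open>m * p\<close>. Its least positive member is \<open>k'\<close>, so the indices of small
  divisors form the arithmetic progression \<open>k', k' + m * p, k' + 2 * m * p, \<dots>\<close>.
\<close>

lemma k'_of_props:
  fixes l :: "'a::abs_valued_field"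
  assumes char: "CHAR('a) > 0" and l: "m_exists l"
  shows CHAR_dvd_k'_of: "CHAR('a) dvd k'_of l" and m_of_dvd_k'_of: "m_of l dvd k'_of l - 1"
    and k'_of_ge_2: "2 \<le> k'_of l" and k'_of_le: "k'_of l \<le> m_of l * CHAR('a)"
    and small_divisor_index:
      "n \<ge> 1 \<Longrightarrow> CHAR('a) dvd n \<Longrightarrow> m_of l dvd n - 1 \<Longrightarrow>
        \<exists>q. n = k'_of l + q * (m_of l * CHAR('a))"
proof -
  let ?p = "CHAR('a)" and ?m = "m_of l" and ?k = "k'_of l"
  let ?P = "\<lambda>k. k \<ge> 1 \<and> ?p dvd k \<and> ?m dvd k - 1"
  have p: "prime ?p" using char by (rule prime_CHAR_semidom)
  have m: "?m \<ge> 1" by (rule m_of_ge_1[OF l])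
  have coprime: "coprime ?p ?m"
    using CHAR_not_dvd_m_of[OF char l] p by (simp add: prime_imp_coprime)
  have "\<exists>k. ?P k"
  proof -
    obtain x y where "?p * x = ?m * y + 1"
      using bezout_nat[of ?p ?m] coprime_imp_gcd_eq_1[OF coprime] char by auto
    then have "?p * x \<ge> 1" "?m dvd ?p * x - 1" by simp_all
    then have "?P (?p * x)" by simp
    then show ?thesis by blast
  qed
  then have "?P ?k" unfolding k'_of_def by (rule LeastI_ex[of ?P])
  then have k: "?k \<ge> 1" "?p dvd ?k" "?m dvd ?k - 1" by auto
  have least: "?k \<le> n" if "?P n" for n
    using Least_le[of ?P n] that by (simp add: k'_of_def)
  show "?p dvd ?k" "?m dvd ?k - 1" by (rule k)+
  show "2 \<le> ?k" using k prime_ge_2_nat[OF p] dvd_imp_le[of ?p ?k] by linarith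
  show "?k \<le> ?m * ?p"
  proof (rule ccontr)
    assume gt: "\<not> ?thesis"
    have "?k - ?m * ?p - 1 = (?k - 1) - ?m * ?p" by simp
    also have "?m dvd \<dots>" by (rule dvd_diff_nat[OF k(3)]) simp
    finally have "?m dvd ?k - ?m * ?p - 1" .
    moreover have "?p dvd ?k - ?m * ?p" by (rule dvd_diff_nat[OF k(2)]) simp
    moreover have "1 \<le> ?k - ?m * ?p" using gt by linarith
    ultimately have "?k \<le> ?k - ?m * ?p" using least[of "?k - ?m * ?p"] by blast
    moreover have "0 < ?m * ?p" using m char by simp
    ultimately show False using gt by linarith
  qed
  assume n: "n \<ge> 1" "?p dvd n" "?m dvd n - 1"
  then have le: "?k \<le> n" using least[of n] by blast
  have "n - ?k = (n - 1) - (?k - 1)" using k(1) le by linarith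
  also have "?m dvd \<dots>" using n(3) k(3) by (rule dvd_diff_nat)
  finally have "?m dvd n - ?k" .
  moreover have "?p dvd n - ?k" using n(2) k(2) by (rule dvd_diff_nat)
  ultimately have "?m * ?p dvd n - ?k" using coprime
    by (intro divides_mult) (simp_all add: coprime_commute)
  then obtain q where "n - ?k = ?m * ?p * q" by (rule dvdE)
  then have "n = ?k + q * (?m * ?p)" using le by (simp add: mult_ac)
  then show "\<exists>q. n = ?k + q * (?m * ?p)" by blast
qed

section \<open>Counting small divisors\<close>

text \<open>
  The number of members of \<open>k, k + M, k + 2 * M, \<dots>\<close> that are at most \<open>n\<close>.
\<close>

definition progression_count :: "nat \<Rightarrow> nat \<Rightarrow> nat \<Rightarrow> nat" where
  "progression_count k M n = (if n < k then 0 else (n - k) div M + 1)"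

lemma progression_count_mono: "i \<le> n \<Longrightarrow> progression_count k M i \<le> progression_count k M n"
  by (auto simp: progression_count_def intro: div_le_mono)

lemma progression_count_Suc_le:
  assumes "i < k + q * M" "M > 0"
  shows "Suc (progression_count k M i) \<le> progression_count k M (k + q * M)"
proof (cases "i < k")
  case False
  then have "i - k < q * M" using assms by linarith
  then have "(i - k) div M < q" using assms by (simp add: div_less_iff_less_mult)
  then show ?thesis using False assms by (simp add: progression_count_def)
qed (simp add: progression_count_def)

text \<open>
  The asymptotic slope \<open>1 / M\<close> of the counting function determines the radius \<open>\<rho>\<close>.
\<close>

lemma progression_count_le_slope:
  assumes "M > 0"
  shows "real (progression_count k M n) \<le> 1 + 1 / real M * real n"
proof (cases "n < k")
  case False
  have "real ((n - k) div M) \<le> real (n - k) / real M" by (rule of_nat_div_le_of_nat)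
  also have "\<dots> \<le> real n / real M" by (intro divide_right_mono) auto
  finally show ?thesis using False by (simp add: progression_count_def)
qed (simp add: progression_count_def)

text \<open>
  The line through \<open>(1, 0)\<close> and \<open>(k, 1)\<close> meets the count at its first jump and, because \<open>k - 1 < M\<close>,
  passes above all later ones. Its slope determines the radius \<open>\<sigma>\<close>; that it vanishes at \<open>n = 1\<close> is what
  turns the coefficient bound into \<open>\<bar>g\<^sub>n\<bar> \<le> b ^ (n - 1)\<close>, without a multiplicative constant.
\<close>

lemma progression_count_le_chord:
  assumes k: "2 \<le> k" "k \<le> M" and n: "1 \<le> n"
  shows "real (progression_count k M n) \<le> - (1 / (real k - 1)) + 1 / (real k - 1) * real n"
proof -
  have *: "- (1 / (real k - 1)) + 1 / (real k - 1) * real n = (real n - 1) / (real k - 1)"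
    by (simp add: diff_divide_distrib)
  show ?thesis
  proof (cases "n < k")
    case False
    have "real ((n - k) div M) \<le> real (n - k) / real M" by (rule of_nat_div_le_of_nat)
    also have "\<dots> \<le> real (n - k) / (real k - 1)" using k by (intro divide_left_mono) auto
    finally show ?thesis using False k
      unfolding * by (simp add: progression_count_def field_simps of_nat_diff)
  next
    case True
    then show ?thesis
      unfolding * using k n by (simp add: progression_count_def)
  qed
qed

section \<open>Coefficients of the conjugacy\<close>

text \<open>
  Raising the supremum condition to the power \<open>n - 1\<close> gives \<open>\<bar>f\<^sub>n\<bar> \<le> a ^ (n - 1)\<close> for \<open>n \<ge> 2\<close>, and \<open>\<bar>l\<bar> = 1\<close>
  gives the same bound for \<open>n = 1\<close>.
\<close>

lemma F_family_props:
  fixes l :: "'a::abs_valued_field"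
  assumes f: "f \<in> F_family l a" and a: "a > 0" and l: "abs_val l = 1"
  shows F_family_0: "f $ 0 = 0" and F_family_1: "f $ 1 = l"
    and F_family_eq_0: "n \<noteq> 1 \<Longrightarrow> \<not> CHAR('a) dvd n \<Longrightarrow> f $ n = 0"
    and F_family_geom_bounded: "geom_bounded (1 / a) a f"
proof -
  show f0: "f $ 0 = 0" and f1: "f $ 1 = l" using f by (auto simp: F_family_def)
  show "f $ n = 0" if "n \<noteq> 1" "\<not> CHAR('a) dvd n"
  proof (cases "n = 0")
    case False
    then have "n \<ge> 2" using that by simp
    then show ?thesis using f that by (auto simp: F_family_def)
  qed (simp add: f0)
  show "geom_bounded (1 / a) a f"
    unfolding geom_bounded_def
  proof
    fix n :: nat
    consider "n = 0" | "n = 1" | "n \<ge> 2" by linarith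
    then show "abs_val (f $ n) \<le> 1 / a * a ^ n"
    proof cases
      case 1 then show ?thesis using a f0 by simp
    next
      case 2 then show ?thesis using a f1 l by simp
    next
      case 3
      let ?v = "abs_val (f $ n)"
      have "?v powr (1 / (real n - 1)) \<le> a"
        using f 3 by (auto simp: F_family_def intro!: cSUP_upper)
      then have "(?v powr (1 / (real n - 1))) powr (real n - 1) \<le> a powr (real n - 1)"
        using 3 by (intro powr_mono2) auto
      moreover have "(?v powr (1 / (real n - 1))) powr (real n - 1) = ?v"
        using 3 by (simp add: powr_powr abs_val_nonneg)
      moreover have "a powr (real n - 1) = 1 / a * a ^ n"
        using a by (simp add: powr_diff powr_realpow)
      ultimately show ?thesis by simp
    qed
  qed
qed

text \<open>
  The derivative of \<open>u ^ i\<close> is \<open>i * u' * u ^ (i - 1) = 0\<close>, and a series with vanishing derivative involves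
  only exponents that are multiples of the characteristic.
\<close>

lemma fps_power_CHAR_multiple_nth:
  fixes u :: "'a::idom fps"
  assumes "CHAR('a) dvd i" "\<not> CHAR('a) dvd n"
  shows "(u ^ i) $ n = 0"
proof -
  have n: "n \<noteq> 0" using assms(2) by (metis dvd_0_right)
  have "of_nat i = (0 :: 'a)" using assms(1) by (simp add: of_nat_eq_0_iff_char_dvd)
  then have "fps_deriv (u ^ i) = 0" by (simp add: fps_deriv_power)
  then have "fps_deriv (u ^ i) $ (n - 1) = 0" by simp
  then have "of_nat n * (u ^ i) $ n = 0" using n by simp
  then show ?thesis using assms(2) by (simp add: of_nat_eq_0_iff_char_dvd)
qed

text \<open>
  The coefficient of \<open>x ^ n\<close> in \<open>g oo f = l * g\<close>, with the term of \<open>f ^ n = l ^ n * x ^ n + \<dots>\<close> isolated.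
\<close>

lemma is_conjugacy_recursion:
  fixes g :: "'a::field fps"
  assumes g: "is_conjugacy l f g" and f: "f $ 0 = 0" "f $ 1 = l"
  shows "g $ n * (l - l ^ n) = (\<Sum>i<n. g $ i * (f ^ i) $ n)"
proof -
  have "{0..n} = insert n {..<n}" by auto
  then have "(g oo f) $ n = (\<Sum>i<n. g $ i * (f ^ i) $ n) + g $ n * l ^ n"
    using startsby_zero_power_nth_same[OF f(1), of n] f(2) by (simp add: fps_compose_nth)
  moreover have "(g oo f) $ n = l * g $ n" using g by (simp add: is_conjugacy_def)
  ultimately show ?thesis by (simp add: algebra_simps)
qed

lemma not_root_of_unity_divisor:
  fixes l :: "'a::field"
  assumes "l \<noteq> 0" "\<not> root_of_unity l" "n \<noteq> 1"
  shows "l - l ^ n \<noteq> 0"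
proof
  assume eq: "l - l ^ n = 0"
  show False
  proof (cases n)
    case 0
    then have "l ^ 1 = 1" using eq by simp
    then show False using assms(2) unfolding root_of_unity_def by blast
  next
    case (Suc k)
    then have "l ^ k = 1" "k \<ge> 1" using eq assms by auto
    then show False using assms(2) unfolding root_of_unity_def by blast
  qed
qed

text \<open>
  The shape of \<open>f\<close> is inherited by \<open>g\<close>: in the recursion for \<open>g\<^sub>n\<close> the index \<open>i = 1\<close> contributes the
  coefficient of \<open>f\<close>, and an index \<open>i\<close> divisible by \<open>p\<close> contributes a coefficient of a \<open>p\<close>-th power;
  both vanish if \<open>p\<close> does not divide \<open>n\<close>.
\<close>

lemma conjugacy_support:
  fixes g :: "'a::field fps"
  assumes g: "is_conjugacy l f g" and l: "l \<noteq> 0" "\<not> root_of_unity l"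
    and f: "f $ 0 = 0" "f $ 1 = l" "\<And>n. n \<noteq> 1 \<Longrightarrow> \<not> CHAR('a) dvd n \<Longrightarrow> f $ n = 0"
    and n: "n \<noteq> 1" "\<not> CHAR('a) dvd n"
  shows "g $ n = 0"
  using n
proof (induction n rule: less_induct)
  case (less n)
  have "g $ i * (f ^ i) $ n = 0" if "i < n" for i
  proof (cases "i = 1 \<or> CHAR('a) dvd i")
    case True
    then show ?thesis
      using less.prems f(3) fps_power_CHAR_multiple_nth[of i n f] by auto
  qed (use less.IH that in auto)
  then have "(\<Sum>i<n. g $ i * (f ^ i) $ n) = 0" by (intro sum.neutral ballI) simp
  then have "g $ n * (l - l ^ n) = 0" by (simp only: is_conjugacy_recursion[OF g f(1,2)])
  then show ?case using not_root_of_unity_divisor[OF l less.prems(1)] by simp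
qed

text \<open>
  If no divisor were small, the recursion would give \<open>\<bar>g\<^sub>n\<bar> \<le> a ^ (n - 1)\<close>. Each division by a small divisor
  costs a factor \<open>D\<close>, and by the ultrametric inequality the costs accumulate only along a single
  increasing chain of indices, which meets each small divisor at most once.
\<close>

lemma conjugacy_coeff_bound:
  fixes l :: "'a::abs_valued_field"
  assumes char: "CHAR('a) > 0" and l: "\<not> root_of_unity l" "m_exists l"
    and a: "a > 0" and f: "f \<in> F_family l a" and g: "is_conjugacy l f g"
  defines "D \<equiv> 1 / abs_val (1 - l ^ m_of l)"
    and "N \<equiv> progression_count (k'_of l) (m_of l * CHAR('a))"
  shows "abs_val (g $ n) \<le> 1 / a * a ^ n * D ^ N n"
proof (induction n rule: less_induct)
  case (less n)
  have l1: "abs_val l = 1" by (rule abs_val_multiplier[OF char l(2)])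
  then have l0: "l \<noteq> 0" by auto
  note fp = F_family_props[OF f a l1]
  have delta: "abs_val (1 - l ^ m_of l) > 0" by (rule abs_val_divisor_pos[OF l])
  then have D: "D \<ge> 1" using m_of_less_1[OF l(2)] by (simp add: D_def)
  have nonneg: "0 \<le> 1 / a * a ^ n * D ^ N n" using a D by simp
  have mp: "m_of l * CHAR('a) > 0" using char m_of_ge_1[OF l(2)] by simp
  consider "n = 1" | "n \<noteq> 1" "\<not> CHAR('a) dvd n" | "n = 0" | "n \<ge> 2" "CHAR('a) dvd n" by linarith
  then show ?case
  proof cases
    case 1
    then show ?thesis using g a one_le_power[OF D, of "N 1"] by (simp add: is_conjugacy_def)
  next
    case 2
    then show ?thesis using conjugacy_support[OF g l0 l(1) fp(1-3)] nonneg by simp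
  next
    case 3
    then show ?thesis using g nonneg by (simp add: is_conjugacy_def)
  next
    case 4
    obtain k where k: "n = Suc k" using 4 by (cases n) auto
    \<comment> \<open>The characteristic divides \<open>n\<close>, hence not \<open>n - 1\<close>: the divisor \<open>l - l ^ n\<close> is never one of the
      smaller numbers \<open>(1 - l ^ m) ^ p\<close>, \<open>(1 - l ^ m) ^ p\<^sup>2\<close> and so on.\<close>
    have "\<not> CHAR('a) dvd k"
      using 4 k char prime_CHAR_semidom[OF char]
      by (metis Suc_eq_plus1 dvd_add_right_iff not_prime_unit)
    have div_abs: "abs_val (l - l ^ n) = abs_val (1 - l ^ k)"
    proof -
      have "l - l ^ n = l * (1 - l ^ k)" by (simp add: k algebra_simps)
      then show ?thesis by (simp add: abs_val_mult l1)
    qed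
    have div_pos: "abs_val (l - l ^ n) > 0"
      using not_root_of_unity_divisor[OF l0 l(1), of n] 4 abs_val_nonneg[of "l - l ^ n"]
      by (auto simp: abs_val_eq_zero less_le)
    \<comment> \<open>A division by a small divisor costs one factor \<open>D\<close>, and the count rises at exactly these
      indices; every other division costs nothing.\<close>
    have step: "D ^ N i \<le> D ^ N n * abs_val (l - l ^ n)" if "i < n" for i
    proof (cases "m_of l dvd k")
      case True
      then obtain q where "n = k'_of l + q * (m_of l * CHAR('a))"
        using small_divisor_index[OF char l(2), of n] 4 k by auto
      then have "Suc (N i) \<le> N n"
        using progression_count_Suc_le[OF _ mp] that unfolding N_def by simp
      then have "D * D ^ N i \<le> D ^ N n"
        using power_increasing[OF _ D, of "Suc (N i)"] by simp
      moreover have "abs_val (l - l ^ n) = 1 / D"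
        using abs_val_divisor_eq[OF char l(2) True \<open>\<not> CHAR('a) dvd k\<close>] by (simp add: div_abs D_def)
      ultimately show ?thesis using D by (simp add: pos_le_divide_eq mult.commute)
    next
      case False
      have "D ^ N i \<le> D ^ N n"
        unfolding N_def using that by (intro power_increasing[OF _ D] progression_count_mono) simp
      also have "\<dots> \<le> D ^ N n * abs_val (l - l ^ n)"
        using abs_val_divisor_ge_1[OF char l(2) False] D
          mult_left_mono[of 1 "abs_val (l - l ^ n)" "D ^ N n"] by (simp add: div_abs)
      finally show ?thesis .
    qed
    have "abs_val (\<Sum>i<n. g $ i * (f ^ i) $ n) \<le> 1 / a * a ^ n * (D ^ N n * abs_val (l - l ^ n))"
    proof (rule abs_val_sum_le[OF char])
      show "0 \<le> 1 / a * a ^ n * (D ^ N n * abs_val (l - l ^ n))"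
        using a D by (simp add: abs_val_nonneg)
      fix i assume "i \<in> {..<n}"
      then have i: "i < n" by simp
      have "abs_val ((f ^ i) $ n) \<le> (1 / a) ^ i * a ^ n"
        using geom_bounded_power[OF char _ fp(4)] a by (simp add: geom_bounded_def)
      then have "abs_val (g $ i * (f ^ i) $ n) \<le> (1 / a * a ^ i * D ^ N i) * ((1 / a) ^ i * a ^ n)"
        unfolding abs_val_mult using less[OF i] a D by (intro mult_mono) (auto simp: abs_val_nonneg)
      also have "\<dots> = 1 / a * a ^ n * D ^ N i" using a by (simp add: power_divide)
      also have "\<dots> \<le> 1 / a * a ^ n * (D ^ N n * abs_val (l - l ^ n))"
        using step[OF i] a by (intro mult_left_mono) auto
      finally show "abs_val (g $ i * (f ^ i) $ n) \<le> 1 / a * a ^ n * (D ^ N n * abs_val (l - l ^ n))" .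
    qed
    then have "abs_val (g $ n) * abs_val (l - l ^ n) \<le> 1 / a * a ^ n * D ^ N n * abs_val (l - l ^ n)"
      unfolding is_conjugacy_recursion[OF g fp(1,2), symmetric] abs_val_mult by (simp add: mult_ac)
    then show ?thesis using div_pos by (rule mult_right_le_imp_le)
  qed
qed

text \<open>
  Any affine bound on the count of small divisors turns the previous estimate into a geometric one.
\<close>

lemma conjugacy_geom_bounded:
  fixes l :: "'a::abs_valued_field"
  assumes char: "CHAR('a) > 0" and l: "\<not> root_of_unity l" "m_exists l"
    and a: "a > 0" and f: "f \<in> F_family l a" and g: "is_conjugacy l f g"
  defines "D \<equiv> 1 / abs_val (1 - l ^ m_of l)"
  assumes N: "\<And>n. 1 \<le> n \<Longrightarrow>
    real (progression_count (k'_of l) (m_of l * CHAR('a)) n) \<le> e + th * real n"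
  shows "geom_bounded (D powr e / a) (a * D powr th) g"
  unfolding geom_bounded_def
proof
  fix n
  let ?N = "progression_count (k'_of l) (m_of l * CHAR('a)) n"
  have "abs_val (1 - l ^ m_of l) > 0" by (rule abs_val_divisor_pos[OF l])
  then have D: "D \<ge> 1" using m_of_less_1[OF l(2)] by (simp add: D_def)
  show "abs_val (g $ n) \<le> D powr e / a * (a * D powr th) ^ n"
  proof (cases "n = 0")
    case True
    then show ?thesis using g a by (simp add: is_conjugacy_def)
  next
    case False
    have "D ^ ?N = D powr real ?N" using D by (simp add: powr_realpow)
    also have "\<dots> \<le> D powr (e + th * real n)" using N[of n] False D by (intro powr_mono) auto
    also have "\<dots> = D powr e * (D powr th) ^ n"
      using D by (simp add: powr_add powr_powr flip: powr_realpow)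
    finally have "1 / a * a ^ n * D ^ ?N \<le> 1 / a * a ^ n * (D powr e * (D powr th) ^ n)"
      using a by (intro mult_left_mono) auto
    with conjugacy_coeff_bound[OF char l a f g, of n] show ?thesis
      unfolding D_def by (simp add: power_mult_distrib mult_ac)
  qed
qed

section \<open>Coefficients of the compositional inverse\<close>

text \<open>
  In \<open>h ^ i - h' ^ i = (h - h') * \<Sum> h' ^ (i - 1 - j) * h ^ j\<close> the first factor starts in degree \<open>n\<close>, and
  for \<open>i \<ge> 2\<close> the second one has no constant term.
\<close>

lemma fps_power_nth_cutoff:
  fixes h h' :: "'a::comm_ring_1 fps"
  assumes eq: "\<And>j. j < n \<Longrightarrow> h $ j = h' $ j" and 0: "h $ 0 = 0" "h' $ 0 = 0" and i: "i \<ge> 2"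
  shows "(h ^ i) $ n = (h' ^ i) $ n"
proof -
  let ?s = "\<Sum>j<i. h' ^ (i - Suc j) * h ^ j"
  have "?s $ 0 = (\<Sum>j<i. 0)"
    unfolding fps_sum_nth
  proof (rule sum.cong)
    fix j assume "j \<in> {..<i}"
    then show "(h' ^ (i - Suc j) * h ^ j) $ 0 = 0"
      using i 0 by (cases j) (auto simp: fps_power_zeroth power_0_left)
  qed simp
  then have s0: "?s $ 0 = 0" by simp
  have "(h ^ i - h' ^ i) $ n = ((h - h') * ?s) $ n" by (simp only: power_diff_sumr2)
  also have "\<dots> = (\<Sum>j=0..n. (h - h') $ j * ?s $ (n - j))" by (rule fps_mult_nth)
  also have "\<dots> = (\<Sum>j=0..n. 0)"
  proof (rule sum.cong)
    fix j assume "j \<in> {0..n}"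
    then show "(h - h') $ j * ?s $ (n - j) = 0"
      using eq s0 by (cases "j = n") auto
  qed simp
  finally show ?thesis by simp
qed

text \<open>
  With \<open>h\<close> the inverse, \<open>h = x - \<Sum> g\<^sub>i * h ^ i\<close> over \<open>i \<ge> 2\<close> expresses \<open>h\<^sub>n\<close> by lower coefficients of \<open>h\<close>,
  and the bound passes through the powers \<open>h ^ i\<close>.
\<close>

lemma geom_bounded_fps_inv:
  fixes g :: "'a::abs_valued_field fps"
  assumes char: "CHAR('a) > 0" and b: "b > 0" and g: "geom_bounded (1 / b) b g"
    and g0: "g $ 0 = 0" and g1: "g $ 1 = 1"
  shows "geom_bounded (1 / b) b (fps_inv g)"
proof -
  define h where "h = fps_inv g"
  have h0: "h $ 0 = 0" by (simp add: h_def fps_inv_def)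
  have gh: "g oo h = fps_X" unfolding h_def using g0 g1 by (intro fps_inv_right) auto
  have "abs_val (h $ n) \<le> 1 / b * b ^ n" for n
  proof (induction n rule: less_induct)
    case (less n)
    consider "n = 0" | "n \<ge> 1" by linarith
    then show ?case
    proof cases
      case 1
      then show ?thesis using b h0 by simp
    next
      case 2
      \<comment> \<open>Powers \<open>h ^ i\<close> with \<open>i \<ge> 2\<close> do not see the coefficient of degree \<open>n\<close>, so the induction
        hypothesis bounds them through a truncation of \<open>h\<close>.\<close>
      define h' where "h' = Abs_fps (\<lambda>j. if j < n then h $ j else 0)"
      have h': "geom_bounded (1 / b) b h'"
        using less b by (auto simp: geom_bounded_def h'_def)
      have "{0..n} = insert 0 (insert 1 {2..n})" using 2 by auto
      then have "fps_X $ n = h $ n + (\<Sum>i\<in>{2..n}. g $ i * (h ^ i) $ n)"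
        unfolding gh[symmetric] fps_compose_nth using g1 by (simp add: g0)
      also have "(\<Sum>i\<in>{2..n}. g $ i * (h ^ i) $ n) = (\<Sum>i\<in>{2..n}. g $ i * (h' ^ i) $ n)"
        using fps_power_nth_cutoff[of n h h'] 2 h0 by (intro sum.cong) (auto simp: h'_def)
      finally have hn: "h $ n = fps_X $ n - (\<Sum>i\<in>{2..n}. g $ i * (h' ^ i) $ n)"
        by simp
      show ?thesis
        unfolding hn
      proof (rule abs_val_ultrametric_diff[OF char])
        show "abs_val ((fps_X :: 'a fps) $ n) \<le> 1 / b * b ^ n"
          using b by (cases "n = 1") auto
        show "abs_val (\<Sum>i\<in>{2..n}. g $ i * (h' ^ i) $ n) \<le> 1 / b * b ^ n"
        proof (rule abs_val_sum_le[OF char])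
          fix i
          have "abs_val ((h' ^ i) $ n) \<le> (1 / b) ^ i * b ^ n"
            using geom_bounded_power[OF char _ h'] b by (simp add: geom_bounded_def)
          then have "abs_val (g $ i * (h' ^ i) $ n) \<le> (1 / b * b ^ i) * ((1 / b) ^ i * b ^ n)"
            unfolding abs_val_mult using g b
            by (intro mult_mono) (auto simp: geom_bounded_def abs_val_nonneg)
          also have "\<dots> = 1 / b * b ^ n" using b by (simp add: power_divide)
          finally show "abs_val (g $ i * (h' ^ i) $ n) \<le> 1 / b * b ^ n" .
        qed (use b in simp)
      qed
    qed
  qed
  then show ?thesis by (simp add: geom_bounded_def h_def)
qed

section \<open>The discs of conjugacy\<close>

theorem theorem4:
  fixes l :: "'a::{abs_valued_field, complete_space}"
    and a :: real and p :: nat and f :: "'a fps"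
  assumes "CHAR('a) = p" and "p > 0"
    and "nontrivial_abs_val TYPE('a)"
    and "\<not> root_of_unity l" and "m_exists l"
    and "a > 0" and "f \<in> F_family l a"
  shows "semi_conjugacy_on
           (open_disc (abs_val (1 - l ^ m_of l) powr (1 / (real (m_of l) * real p)) / a))
           l f (conjugacy_function l f)
       \<and> full_conjugacy_on
           (open_disc (abs_val (1 - l ^ m_of l) powr (1 / (real (k'_of l) - 1)) / a))
           l f (conjugacy_function l f)"
proof -
  have char: "CHAR('a) > 0" using assms by simp
  note l = assms(4,5) and a = assms(6) and f = assms(7)
  define g where "g = conjugacy_function l f"
  define D where "D = 1 / abs_val (1 - l ^ m_of l)"
  \<comment> \<open>\<open>b\<close> and \<open>c\<close> are the reciprocals of the radii \<open>\<sigma>\<close> and \<open>\<rho>\<close>.\<close>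
  define b where "b = a * D powr (1 / (real (k'_of l) - 1))"
  define c where "c = a * D powr (1 / real (m_of l * CHAR('a)))"
  have l1: "abs_val l = 1" by (rule abs_val_multiplier[OF char l(2)])
  then have l0: "l \<noteq> 0" by auto
  note fp = F_family_props[OF f a l1]
  have g: "is_conjugacy l f g"
    unfolding g_def conjugacy_function_def
    by (rule theI') (rule is_conjugacy_ex1[OF l0 l(1) fp(1,2)])
  have g0: "g $ 0 = 0" and g1: "g $ 1 = 1" and gf: "g oo f = fps_const l * g"
    using g by (auto simp: is_conjugacy_def)
  have delta: "abs_val (1 - l ^ m_of l) > 0" by (rule abs_val_divisor_pos[OF l])
  then have D: "D \<ge> 1" using m_of_less_1[OF l(2)] by (simp add: D_def)
  note k = k'_of_ge_2[OF char l(2)] k'_of_le[OF char l(2)]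
  have mp: "m_of l * CHAR('a) > 0" using k by linarith
  have gc: "geom_bounded (D powr 1 / a) c g"
    unfolding D_def c_def
    by (rule conjugacy_geom_bounded[OF char l a f g progression_count_le_slope[OF mp]])
  have "geom_bounded (D powr (- (1 / (real (k'_of l) - 1))) / a) b g"
    unfolding D_def b_def
    by (rule conjugacy_geom_bounded[OF char l a f g progression_count_le_chord[OF k]])
  moreover have "D powr (- (1 / (real (k'_of l) - 1))) / a = 1 / b"
    using D a by (simp add: b_def powr_minus field_simps)
  ultimately have gb: "geom_bounded (1 / b) b g" by simp
  have ac: "a \<le> c" and c0: "0 < c"
    using a D ge_one_powr_ge_zero[OF D, of "1 / real (m_of l * CHAR('a))"] by (auto simp: c_def)
  have cb: "c \<le> b"
    unfolding c_def b_def using a k D mp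
    by (intro mult_left_mono powr_mono divide_left_mono) (auto simp flip: of_nat_mult)
  have b0: "0 < b" using c0 cb by simp
  have rho: "abs_val (1 - l ^ m_of l) powr (1 / (real (m_of l) * real p)) / a = 1 / c"
    using delta assms(1) by (simp add: c_def D_def powr_divide)
  have sigma: "abs_val (1 - l ^ m_of l) powr (1 / (real (k'_of l) - 1)) / a = 1 / b"
    using delta by (simp add: b_def D_def powr_divide)
  have semi: "ps_converges g x \<and> ps_converges f x \<and> ps_converges g (ps_eval f x)
      \<and> ps_eval g (ps_eval f x) = l * ps_eval g x" if x: "c * abs_val x < 1" for x
  proof -
    have ax: "a * abs_val x < 1"
      using x mult_right_mono[OF ac abs_val_nonneg[of x]] by simp
    have "abs_val (ps_eval f x) \<le> abs_val x"
      by (rule abs_val_ps_eval_le[OF char a ax fp(1,4)])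
    then have fx: "c * abs_val (ps_eval f x) < 1"
      using x mult_left_mono[of "abs_val (ps_eval f x)" "abs_val x" c] c0 by linarith
    show ?thesis
      using ps_converges_geom_bounded[OF char _ x gc] ps_converges_geom_bounded[OF char _ ax fp(4)]
        ps_converges_geom_bounded[OF char _ fx gc] ps_eval_compose[OF char a ac x fp(1,4) gc]
        ps_eval_fps_const_mult[OF char _ x gc, of l] a c0 by (simp add: gf)
  qed
  define h where "h = fps_inv g"
  have h0: "h $ 0 = 0" by (simp add: h_def fps_inv_def)
  have hb: "geom_bounded (1 / b) b h"
    unfolding h_def by (rule geom_bounded_fps_inv[OF char b0 gb g0 g1])
  have hg: "h oo g = fps_X" and gh: "g oo h = fps_X"
    unfolding h_def using g0 g1 by (intro fps_inv fps_inv_right; simp)+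
  \<comment> \<open>Both formal inverse identities survive evaluation; the first gives injectivity of \<open>g\<close>.\<close>
  have inv: "ps_eval h (ps_eval g x) = x" "ps_eval g (ps_eval h x) = x"
    if x: "b * abs_val x < 1" for x
    using ps_eval_compose[OF char b0 order_refl x g0 gb hb]
      ps_eval_compose[OF char b0 order_refl x h0 hb gb] by (simp_all add: hg gh)
  have full: "ps_converges g x \<and> ps_converges h x \<and> ps_converges f (ps_eval h x)
      \<and> ps_converges g (ps_eval f (ps_eval h x)) \<and> ps_eval g (ps_eval f (ps_eval h x)) = l * x"
    if x: "b * abs_val x < 1" for x
  proof -
    have "abs_val (ps_eval h x) \<le> abs_val x"
      by (rule abs_val_ps_eval_le[OF char b0 x h0 hb])
    then have "c * abs_val (ps_eval h x) \<le> b * abs_val x"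
      using cb b0 by (intro mult_mono) (auto simp: abs_val_nonneg)
    then have "c * abs_val (ps_eval h x) < 1" using x by simp
    from semi[OF this] show ?thesis
      using ps_converges_geom_bounded[OF char _ x gb] ps_converges_geom_bounded[OF char _ x hb]
        inv(2)[OF x] b0 by simp
  qed
  have "semi_conjugacy_on (open_disc (1 / c)) l f g"
    using semi c0 by (simp add: semi_conjugacy_on_def open_disc_def field_simps)
  moreover have "full_conjugacy_on (open_disc (1 / b)) l f g"
  proof -
    have disc: "b * abs_val x < 1" if "x \<in> open_disc (1 / b)" for x
      using that b0 by (simp add: open_disc_def field_simps)
    have "inj_on (ps_eval g) (open_disc (1 / b))"
      using inv(1) disc by (intro inj_on_inverseI[of _ "ps_eval h"]) auto
    then show ?thesis
      using full disc by (auto simp: full_conjugacy_on_def h_def)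
  qed
  ultimately show ?thesis unfolding rho sigma g_def by blast
qed

end
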